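(* Let $n\ge 1$ and let $i,j$ be integers with $0\le i\le j\le n$, $\frac{i}{2}+j\le n$ and $i+j>n$. If $f\in U_{[i,j]}(n,3)$ and $f\not\equiv 0$, then $$|f|\ge 2^{3(n-j)-i}\cdot 3^{i+j-n}.$$ Moreover, this bound is sharp: for all such $n,i,j$ there exists $f\in U_{[i,j]}(n,3)$, $f\not\equiv 0$, with $|f|=2^{3(n-j)-i}\cdot 3^{i+j-n}$.
   Context: For $q\ge 2$ let $\Sigma_q=\{0,1,\ldots,q-1\}$. The Hamming graph $H(n,q)$ has vertex set $\Sigma_q^n$, and two vertices are adjacent if they differ in exactly one coordinate. The eigenvalues of its adjacency matrix are $\lambda_i(n,q)=n(q-1)-q\cdot i$ for $0\le i\le n$. Let $U_i(n,q)$ be the $\lambda_i(n,q)$-eigenspace, i.e. the space of functions $f:\Sigma_q^n\to\mathbb{R}$ with $\lambda_i(n,q)f(x)=\sum_{y\in N(x)}f(y)$ for every vertex $x$, where $N(x)$ is the set of neighbors of $x$. For $0\le i\le j\le n$ let $U_{[i,j]}(n,q)=U_i(n,q)\oplus U_{i+1}(n,q)\oplus\cdots\oplus U_j(n,q)$. For a function $f:\Sigma_q^n\to\mathbb{R}$, $|f|$ denotes the cardinality of its support $\{x : f(x)\ne 0\}$. *)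

theory Defs
  imports Complex_Main
begin

(* The word x_1 ... x_n over {0, ..., q - 1} is the list [x_1, ..., x_n] :: nat list. *)
definition hamming_verts :: "nat \<Rightarrow> nat \<Rightarrow> nat list set" where
  "hamming_verts n q = {x. length x = n \<and> set x \<subseteq> {..<q}}"

definition hamming_nbrs :: "nat \<Rightarrow> nat \<Rightarrow> nat list \<Rightarrow> nat list set" where
  "hamming_nbrs n q x = {y \<in> hamming_verts n q. card {k. k < n \<and> x ! k \<noteq> y ! k} = 1}"

definition hamming_eigenvalue :: "nat \<Rightarrow> nat \<Rightarrow> nat \<Rightarrow> real" where
  "hamming_eigenvalue n q i = real n * (real q - 1) - real q * real i"

(* A real function on the vertex set is represented by its extension by 0 to all lists.
   This representation is unique, so equality of functions, being identically zero and
   the support need no relativisation to the vertex set. *)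
definition hamming_eigenspace :: "nat \<Rightarrow> nat \<Rightarrow> nat \<Rightarrow> (nat list \<Rightarrow> real) set" where
  "hamming_eigenspace n q i =
     {f. (\<forall>x. x \<notin> hamming_verts n q \<longrightarrow> f x = 0) \<and>
         (\<forall>x \<in> hamming_verts n q.
            hamming_eigenvalue n q i * f x = (\<Sum>y \<in> hamming_nbrs n q x. f y))}"

(* The sum of the eigenspaces i, ..., j. For q > 0 it is automatically direct, because the
   eigenvalues are pairwise distinct. *)
definition hamming_eigenspace_sum ::
    "nat \<Rightarrow> nat \<Rightarrow> nat \<Rightarrow> nat \<Rightarrow> (nat list \<Rightarrow> real) set" where
  "hamming_eigenspace_sum n q i j =
     {f. \<exists>g. (\<forall>k \<in> {i..j}. g k \<in> hamming_eigenspace n q k) \<and>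
             f = (\<lambda>x. \<Sum>k = i..j. g k x)}"

definition fun_support :: "('a \<Rightarrow> real) \<Rightarrow> 'a set" where
  "fun_support f = {x. f x \<noteq> 0}"

end

theory Submission
  imports Defs "HOL-Library.FuncSet"
begin

text \<open>
  Put $s = n - j$. The bound is $(3/2)^i (8/3)^s$, and in this form it holds for all $i$ and $s$,
  not only in the range of the theorem. This makes an induction on the number of coordinates
  possible. Let $f$ be a nonzero function in the sum of the eigenspaces $i, \ldots, j$ and let
  $f_0, f_1, f_2$ be its restrictions to the three values of one coordinate. The differences
  $f_a - f_b$ lie between the eigenspaces $i - 1$ and $j - 1$, the sum $f_0 + f_1 + f_2$ lies
  between $i$ and $j$, and every $f_a$ lies between $i - 1$ and $j$, always in dimension $n - 1$
  (\<open>band_slice_diff\<close>, \<open>band_slice_sum\<close>, \<open>band_slice\<close>). With $\beta$ for the bound, the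
  induction hypothesis thus gives a nonzero difference at least $\frac{2}{3}\beta$ support points.

  If the three restrictions are pairwise distinct for some coordinate, then adding
  $|f_a| + |f_b| \ge |f_a - f_b|$ over the three pairs gives
  $2 |f| \ge 3 \cdot \frac{2}{3} \beta$, which is exactly what is needed
  (\<open>weight_band_bound\<close>). Otherwise every coordinate has two equal restrictions. Such collapsed
  functions satisfy the stronger bounds $(4/3)^i 3^s$ and $3^i (4/3)^s$ (\<open>weight_collapsed\<close>), and the
  larger of the two is at least $\beta$: the first one if $i \le s$, the second one if $i \ge s$.
  Every restriction of a collapsed function is again collapsed, so these two bounds have an
  induction of their own.

  Throughout the induction, membership in a sum of eigenspaces is expressed by orthogonality to
  every eigenfunction with index outside $i, \ldots, j$ (predicate \<open>band\<close>). When two of the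
  restrictions vanish, the third one lies in two such spaces, and a function orthogonal to both
  sets of eigenfunctions visibly lies in the space for the intersection of the two index ranges.

  For sharpness, tensor products add $n$, $i$ and $j$ and multiply the sizes of supports.
  The three factors with $(n, i, j, |f|)$ equal to $(3,2,2,6)$ (the sign of a permutation of the
  three letters), $(2,1,1,4)$ (the difference of two crossing lines) and $(1,0,1,1)$ (a point) are
  taken $i + j - n$, $2(n-j) - i$ and $j - i$ times; the hypotheses imply that these numbers
  are not negative.
\<close>

section \<open>Functions on the cube and their restrictions\<close>

text \<open>Coordinates are elements of an arbitrary index set, so that any of them can be split off.\<close>

definition cube :: "'a set \<Rightarrow> ('a \<Rightarrow> nat) set" where
  "cube I = (I \<rightarrow>\<^sub>E {..<3})"

text \<open>Summing $f$ over all lines through $x$ counts $f(x)$ once per coordinate in addition to the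
  neighbours, so on $n$ coordinates the eigenvalue $2n - 3k$ of the adjacency matrix turns into
  $3(n-k)$. The index is an integer so that it can leave the range $0, \ldots, n$ when a
  coordinate is removed; for such an index only functions vanishing on the cube qualify.\<close>

definition eigenfun :: "'a set \<Rightarrow> int \<Rightarrow> (('a \<Rightarrow> nat) \<Rightarrow> real) \<Rightarrow> bool" where
  "eigenfun I k h \<longleftrightarrow>
     (\<forall>x \<in> cube I. (\<Sum>r\<in>I. \<Sum>b<3. h (x(r := b))) = 3 * (real (card I) - of_int k) * h x)"

text \<open>The sum of the eigenspaces $i, \ldots, j$, described by orthogonality to the other
  eigenfunctions: intersecting two index ranges then amounts to joining two sets of
  conditions.\<close>

definition band :: "'a set \<Rightarrow> int \<Rightarrow> int \<Rightarrow> (('a \<Rightarrow> nat) \<Rightarrow> real) \<Rightarrow> bool" where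
  "band I i j f \<longleftrightarrow>
     (\<forall>k h. eigenfun I k h \<and> (k < i \<or> j < k) \<longrightarrow> (\<Sum>x\<in>cube I. f x * h x) = 0)"

definition weight :: "'a set \<Rightarrow> (('a \<Rightarrow> nat) \<Rightarrow> real) \<Rightarrow> nat" where
  "weight I f = card {x \<in> cube I. f x \<noteq> 0}"

definition slice :: "'a \<Rightarrow> nat \<Rightarrow> (('a \<Rightarrow> nat) \<Rightarrow> real) \<Rightarrow> ('a \<Rightarrow> nat) \<Rightarrow> real" where
  "slice r a f = (\<lambda>x. f (x(r := a)))"

lemma cube_empty: "cube {} = {\<lambda>_. undefined}"
  by (simp add: cube_def)

lemma finite_cube: "finite I \<Longrightarrow> finite (cube I)"
  by (simp add: cube_def finite_PiE)

lemma cube_upd_undefined: "x \<in> cube J \<Longrightarrow> r \<notin> J \<Longrightarrow> x(r := undefined) = x"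
  unfolding cube_def by (rule fun_upd_idem) (rule PiE_arb)

lemma cube_upd: "x \<in> cube J \<Longrightarrow> a < 3 \<Longrightarrow> x(r := a) \<in> cube (insert r J)"
  unfolding cube_def by (rule PiE_fun_upd) simp_all

lemma cube_insertE:
  assumes "y \<in> cube (insert r J)" "r \<notin> J"
  obtains x a where "x \<in> cube J" "a < 3" "y = x(r := a)"
proof -
  have "y \<in> (\<lambda>(a, x). x(r := a)) ` ({..<3} \<times> cube J)"
    using assms(1) unfolding cube_def PiE_insert_eq .
  then obtain a x where ax: "a < 3" "x \<in> cube J" "y = x(r := a)"
    by auto
  show ?thesis
    by (rule that[OF ax(2,1,3)])
qed

lemma sum_cube_insert:
  fixes F :: "('a \<Rightarrow> nat) \<Rightarrow> 'b::comm_monoid_add"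
  assumes "r \<notin> J"
  shows "(\<Sum>x\<in>cube (insert r J). F x) = (\<Sum>x\<in>cube J. \<Sum>a<3. F (x(r := a)))"
proof -
  have "(\<Sum>x\<in>cube (insert r J). F x) = (\<Sum>(a, x)\<in>{..<3} \<times> cube J. F (x(r := a)))"
    unfolding cube_def PiE_insert_eq
    by (subst sum.reindex[OF inj_combinator[OF assms]]) (simp add: case_prod_unfold)
  also have "\<dots> = (\<Sum>a<3. \<Sum>x\<in>cube J. F (x(r := a)))"
    by (rule sum.cartesian_product[symmetric])
  also have "\<dots> = (\<Sum>x\<in>cube J. \<Sum>a<3. F (x(r := a)))"
    by (rule sum.swap)
  finally show ?thesis .
qed

lemma sum_lessThan_3: "(\<Sum>a<(3::nat). F a) = F 0 + F 1 + (F 2 :: 'b::comm_monoid_add)"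
  by (simp add: eval_nat_numeral)

lemma sum_three_letters:
  fixes F :: "nat \<Rightarrow> 'b::comm_monoid_add"
  assumes "a < 3" "b < 3" "c < 3" "a \<noteq> b" "a \<noteq> c" "b \<noteq> c"
  shows "(\<Sum>d<3. F d) = F a + F b + F c"
proof -
  have "{a, b, c} = {..<3}"
    using assms by (intro card_subset_eq) auto
  hence "(\<Sum>d<3. F d) = sum F {a, b, c}"
    by simp
  thus ?thesis
    using assms(4-6) by (simp add: add.assoc)
qed

lemma weight_eq_sum: "finite I \<Longrightarrow> weight I f = (\<Sum>x\<in>cube I. of_bool (f x \<noteq> 0))"
  by (simp add: weight_def finite_cube Int_def)

lemma weight_insert:
  assumes "finite J" "r \<notin> J"
  shows "weight (insert r J) f = (\<Sum>a<3. weight J (slice r a f))"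
proof -
  have "weight (insert r J) f = (\<Sum>x\<in>cube J. \<Sum>a<3. of_bool (slice r a f x \<noteq> 0))"
    using assms by (simp add: weight_eq_sum sum_cube_insert slice_def del: sum_of_bool_eq)
  also have "\<dots> = (\<Sum>a<3. \<Sum>x\<in>cube J. of_bool (slice r a f x \<noteq> 0))"
    by (rule sum.swap)
  finally show ?thesis
    using assms(1) by (simp add: weight_eq_sum)
qed

lemma weight_combination_le:
  assumes "finite I" "\<And>x. x \<in> cube I \<Longrightarrow> f x = 0 \<Longrightarrow> g x = 0 \<Longrightarrow> h x = 0"
  shows "weight I h \<le> weight I f + weight I g"
  using assms unfolding weight_eq_sum[OF assms(1)] sum.distrib[symmetric]
  by (intro sum_mono) (auto simp: of_bool_def)

lemma weight_cong: "(\<And>x. x \<in> cube I \<Longrightarrow> f x = 0 \<longleftrightarrow> g x = 0) \<Longrightarrow> weight I f = weight I g"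
  unfolding weight_def by (rule arg_cong[where f = card]) auto

lemma band_mono: "band I i j f \<Longrightarrow> i' \<le> i \<Longrightarrow> j \<le> j' \<Longrightarrow> band I i' j' f"
  unfolding band_def by fastforce

lemma band_Int: "band I i j f \<Longrightarrow> band I i' j' f \<Longrightarrow> band I (max i i') (min j j') f"
  unfolding band_def less_max_iff_disj min_less_iff_disj by blast

lemma band_cong: "(\<And>x. x \<in> cube I \<Longrightarrow> f x = g x) \<Longrightarrow> band I i j f \<longleftrightarrow> band I i j g"
  unfolding band_def by (simp cong: sum.cong)

lemma band_add: "band I i j f \<Longrightarrow> band I i j g \<Longrightarrow> band I i j (\<lambda>x. f x + g x)"
  unfolding band_def by (simp add: distrib_right sum.distrib)

lemma band_scale: "band I i j f \<Longrightarrow> band I i j (\<lambda>x. c * f x)"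
  unfolding band_def by (simp add: mult.assoc sum_distrib_left[symmetric])

section \<open>Restricting a coordinate\<close>

text \<open>The constant 1 is an eigenfunction of index 0 on the one-point cube. This is the base case
  of both inductions.\<close>

lemma band_empty_nonzero:
  assumes "band {} i j f" "f (\<lambda>_. undefined) \<noteq> 0"
  shows "i \<le> 0" "0 \<le> j"
proof -
  have "eigenfun {} 0 (\<lambda>_. 1)"
    by (simp add: eigenfun_def)
  hence "\<not> (0 < i \<or> j < 0)"
    using assms unfolding band_def by (force simp: cube_empty)
  thus "i \<le> 0" "0 \<le> j"
    by auto
qed

text \<open>Eigenfunctions extend to one more coordinate by multiplication with a function $u$ of that
  coordinate. The hypothesis on $u$ covers the constants ($e = 0$) and the functions with sum zero
  ($e = 1$), which raise the index by one. In the extension the new coordinate is reset to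
  \<^term>\<open>undefined\<close>, because that is its value in the points of the smaller cube.\<close>

lemma eigenfun_insert:
  assumes "finite J" "r \<notin> J" "eigenfun J k h"
    and u: "\<And>b. b < 3 \<Longrightarrow> (\<Sum>a<3. u a) = 3 * (1 - of_int e) * u b"
  shows "eigenfun (insert r J) (k + e) (\<lambda>y. u (y r) * h (y(r := undefined)))"
  unfolding eigenfun_def
proof
  fix y assume "y \<in> cube (insert r J)"
  from this \<open>r \<notin> J\<close> obtain x a where x: "x \<in> cube J" "a < 3" "y = x(r := a)"
    by (rule cube_insertE)
  have xr: "x(r := undefined) = x"
    by (rule cube_upd_undefined[OF x(1) \<open>r \<notin> J\<close>])
  let ?H = "\<lambda>y. u (y r) * h (y(r := undefined))"
  have swap: "x(r := a, s := b, r := undefined) = x(s := b)" if "s \<in> J" for s b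
  proof -
    have "s \<noteq> r"
      using that \<open>r \<notin> J\<close> by blast
    hence "x(r := a, s := b, r := undefined) = x(r := undefined, s := b)"
      by (simp add: fun_upd_twist)
    thus ?thesis
      unfolding xr .
  qed
  have "?H (y(s := b)) = u a * h (x(s := b))" if "s \<in> J" for s b
  proof -
    have "s \<noteq> r"
      using that \<open>r \<notin> J\<close> by blast
    thus ?thesis
      unfolding x(3) swap[OF that] by simp
  qed
  hence "(\<Sum>s\<in>J. \<Sum>b<3. ?H (y(s := b))) = (\<Sum>s\<in>J. \<Sum>b<3. u a * h (x(s := b)))"
    by (intro sum.cong refl)
  also have "\<dots> = u a * (3 * (real (card J) - of_int k) * h x)"
    using assms(3) x(1) by (simp add: eigenfun_def sum_distrib_left[symmetric])
  finally have J: "(\<Sum>s\<in>J. \<Sum>b<3. ?H (y(s := b))) = \<dots>" .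
  have "(\<Sum>b<3. ?H (y(r := b))) = (\<Sum>b<3. u b) * h x"
    using x(3) xr by (simp add: sum_distrib_right)
  also have "\<dots> = 3 * (1 - of_int e) * u a * h x"
    using u[OF x(2)] by simp
  finally show "(\<Sum>s\<in>insert r J. \<Sum>b<3. ?H (y(s := b)))
      = 3 * (real (card (insert r J)) - of_int (k + e)) * ?H y"
    using J x(3) xr assms(1,2) by (simp add: algebra_simps)
qed

text \<open>Dual to the extension of eigenfunctions: pairing a combination of slices with $h$ is the
  same as pairing $f$ with the extension of $h$.\<close>

lemma band_slices:
  assumes "finite J" "r \<notin> J" "band (insert r J) i j f"
    and u: "\<And>b. b < 3 \<Longrightarrow> (\<Sum>a<3. u a) = 3 * (1 - of_int e) * u b"
  shows "band J (i - e) (j - e) (\<lambda>x. \<Sum>a<3. u a * slice r a f x)"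
  unfolding band_def
proof (intro allI impI)
  fix k h assume k: "eigenfun J k h \<and> (k < i - e \<or> j - e < k)"
  have "(\<Sum>x\<in>cube J. (\<Sum>a<3. u a * slice r a f x) * h x)
      = (\<Sum>y\<in>cube (insert r J). f y * (u (y r) * h (y(r := undefined))))"
    unfolding sum_cube_insert[OF \<open>r \<notin> J\<close>]
  proof (rule sum.cong[OF refl])
    fix x assume "x \<in> cube J"
    hence "x(r := undefined) = x"
      by (rule cube_upd_undefined[OF _ \<open>r \<notin> J\<close>])
    thus "(\<Sum>a<3. u a * slice r a f x) * h x
        = (\<Sum>a<3. f (x(r := a)) * (u ((x(r := a)) r) * h ((x(r := a))(r := undefined))))"
      by (simp add: slice_def sum_distrib_right sum_distrib_left mult_ac)
  qed
  also have "\<dots> = 0"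
  proof -
    have "eigenfun (insert r J) (k + e) (\<lambda>y. u (y r) * h (y(r := undefined)))"
      using k u by (intro eigenfun_insert assms) auto
    moreover have "k + e < i \<or> j < k + e"
      using k by linarith
    ultimately show ?thesis
      using assms(3) unfolding band_def by blast
  qed
  finally show "(\<Sum>x\<in>cube J. (\<Sum>a<3. u a * slice r a f x) * h x) = 0" .
qed

lemma band_slice_sum:
  assumes "finite J" "r \<notin> J" "band (insert r J) i j f"
  shows "band J i j (\<lambda>x. \<Sum>a<3. slice r a f x)"
  using band_slices[OF assms, of "\<lambda>_. 1" 0] by simp

lemma band_slice_diff:
  assumes "finite J" "r \<notin> J" "band (insert r J) i j f" "a < 3" "b < 3"
  shows "band J (i - 1) (j - 1) (\<lambda>x. slice r a f x - slice r b f x)"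
proof -
  let ?u = "\<lambda>c. of_bool (c = a) - of_bool (c = b) :: real"
  have sums: "(\<Sum>c<3. ?u c * F c) = F a - F b" for F :: "nat \<Rightarrow> real"
    using assms(4,5) by (simp add: sum_subtractf left_diff_distrib of_bool_def if_distrib[of "\<lambda>x. x * _"] cong: if_cong)
  show ?thesis
    using band_slices[OF assms(1-3), of ?u 1] sums[of "\<lambda>_. 1"] by (simp add: sums)
qed

text \<open>A slice is one third of the sum of all slices plus differences of slices.\<close>

lemma band_slice:
  assumes "finite J" "r \<notin> J" "band (insert r J) i j f" "a < 3"
  shows "band J (i - 1) j (slice r a f)"
proof -
  let ?f = "\<lambda>b. slice r b f"
  define D where "D b = (\<lambda>x. ?f a x - ?f b x)" for b
  have D: "band J (i - 1) j (D b)" if "b < 3" for b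
    using band_mono[OF band_slice_diff[OF assms(1-3) \<open>a < 3\<close> that], of "i - 1" j]
    by (simp add: D_def)
  have S: "band J (i - 1) j (\<lambda>x. \<Sum>b<3. ?f b x)"
    by (rule band_mono[OF band_slice_sum[OF assms(1-3)]]) auto
  have "band J (i - 1) j (\<lambda>x. 1/3 * ((\<Sum>b<3. ?f b x) + (D 0 x + (D 1 x + D 2 x))))"
    by (intro band_scale band_add S D) auto
  thus ?thesis
    by (simp add: D_def sum_lessThan_3 field_simps)
qed

section \<open>Functions with two equal slices in every coordinate\<close>

definition collapsed :: "'a set \<Rightarrow> (('a \<Rightarrow> nat) \<Rightarrow> real) \<Rightarrow> 'a \<Rightarrow> bool" where
  "collapsed I f r \<longleftrightarrow>
     (\<exists>a<3. \<exists>b<3. a \<noteq> b \<and> (\<forall>x \<in> cube (I - {r}). slice r a f x = slice r b f x))"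

text \<open>The same two letters witness the collapse of all slices, hence also of their
  combinations.\<close>

lemma collapsed_slices:
  assumes "collapsed (insert r J) f s" "r \<notin> J" "s \<in> J" "c < 3" "d < 3"
  shows "collapsed J (\<lambda>x. t * slice r c f x + u * slice r d f x) s"
proof -
  obtain a b where ab: "a < 3" "b < 3" "a \<noteq> b"
    and eq: "\<And>x. x \<in> cube (insert r J - {s}) \<Longrightarrow> slice s a f x = slice s b f x"
    using assms(1) unfolding collapsed_def by blast
  have "slice s a (slice r e f) x = slice s b (slice r e f) x" if "x \<in> cube (J - {s})" "e < 3" for x e
  proof -
    have "insert r J - {s} = insert r (J - {s})" "r \<noteq> s"
      using assms(2,3) by auto
    thus ?thesis
      using eq[of "x(r := e)"] cube_upd[OF that, of r]
      by (simp add: slice_def fun_upd_twist)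
  qed
  hence "slice s a (\<lambda>x. t * slice r c f x + u * slice r d f x) x
       = slice s b (\<lambda>x. t * slice r c f x + u * slice r d f x) x" if "x \<in> cube (J - {s})" for x
    using that assms(4,5) by (simp add: slice_def)
  thus ?thesis
    unfolding collapsed_def using ab by blast
qed

lemma powi_le_1:
  fixes x :: real
  assumes "1 \<le> x" "k \<le> 0"
  shows "x powi k \<le> 1"
  using power_int_increasing[OF assms(2,1)] by simp

lemma weight_pos: "finite I \<Longrightarrow> x \<in> cube I \<Longrightarrow> f x \<noteq> 0 \<Longrightarrow> 1 \<le> weight I f"
  unfolding weight_def by (metis (mono_tags, lifting) One_nat_def Suc_leI card_gt_0_iff empty_iff finite_cube
    finite_Collect_conjI finite_subset mem_Collect_eq subsetI Collect_mem_eq)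

lemma weight_empty_bound:
  fixes l m :: real
  assumes "band {} i j f" "x \<in> cube {}" "f x \<noteq> 0" "1 \<le> l" "1 \<le> m"
  shows "l powi i * m powi (int (card ({} :: 'a set)) - j) \<le> real (weight {} (f :: ('a \<Rightarrow> nat) \<Rightarrow> real))"
proof -
  have "i \<le> 0" "0 \<le> j"
    using band_empty_nonzero[of i j f] assms by (auto simp: cube_empty)
  hence "l powi i \<le> 1" "m powi (int (card ({} :: 'a set)) - j) \<le> 1"
    using assms by (auto intro!: powi_le_1)
  hence "l powi i * m powi (int (card ({} :: 'a set)) - j) \<le> 1 * 1"
    using assms by (intro mult_mono) auto
  also have "\<dots> \<le> real (weight {} f)"
    using weight_pos[of "{}" x f] assms(2,3) by simp
  finally show ?thesis .
qed

text \<open>Let $p$ be the slice that occurs twice, $q$ the third one and $G$ the bound, so that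
  $|f| = 2|p| + |q|$. Both $p$ and $q$ have weight at least $G/(lm) = G/4$ or vanish. Among
  $q - p$ and $2p + q$, one has weight at least $\frac{3}{4} G$ or vanishes, because $l$ or $m$ is
  $4/3$, and its weight is at most $|p| + |q|$; adding another $|p| \ge G/4$ gives $G$. In the
  degenerate cases all nonzero slices are proportional, and membership in a narrower range
  of eigenspaces makes up for the loss.\<close>

lemma weight_collapsed:
  fixes l m :: real
  assumes "finite I" "band I i j f" "\<exists>x\<in>cube I. f x \<noteq> 0" "\<forall>r\<in>I. collapsed I f r"
    and lm: "l = 4/3 \<and> m = 3 \<or> l = 3 \<and> m = 4/3"
  shows "l powi i * m powi (int (card I) - j) \<le> weight I f"
  using assms(1-4)
proof (induction I arbitrary: f i j rule: finite_induct)
  case empty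
  then obtain x where "x \<in> cube {}" "f x \<noteq> 0" by blast
  thus ?case
    using weight_empty_bound[of i j f x l m] empty lm by auto
next
  case (insert r J)
  note fJ = insert.hyps(1,2)
  obtain a b where ab: "a < 3" "b < 3" "a \<noteq> b"
    and eq: "\<And>x. x \<in> cube J \<Longrightarrow> slice r a f x = slice r b f x"
    using insert.prems(3) fJ unfolding collapsed_def by (metis Diff_insert_absorb insertI1)
  obtain c where c: "c < 3" "a \<noteq> c" "b \<noteq> c"
  proof -
    have "\<not> {..<3} \<subseteq> {a, b}"
      using card_mono[of "{a, b}" "{..<3}"] card_insert_le_m1[of 2 "{b}" a] by auto
    thus ?thesis using that by auto
  qed
  define p q where "p = slice r a f" and "q = slice r c f"
  define G where "G = l powi i * m powi (int (card (insert r J)) - j)"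
  have l0: "l \<noteq> 0" "m \<noteq> 0" and G0: "G \<ge> 0"
    using lm by (auto simp: G_def)
  have low: "l powi (i - 1) * m powi (int (card J) - (j - 1)) = G / l"
    "l powi i * m powi (int (card J) - j) = G / m"
    "l powi (i - 1) * m powi (int (card J) - j) = G / (l * m)"
    "l powi i * m powi (int (card J) - (j - 1)) = G"
  proof -
    have e: "int (card (insert r J)) - j = int (card J) - j + 1"
       "int (card J) - (j - 1) = int (card J) - j + 1"
      using fJ by auto
    show "l powi (i - 1) * m powi (int (card J) - (j - 1)) = G / l"
      "l powi i * m powi (int (card J) - j) = G / m"
      "l powi (i - 1) * m powi (int (card J) - j) = G / (l * m)"
      "l powi i * m powi (int (card J) - (j - 1)) = G"
      unfolding G_def e using l0 by (simp_all add: power_int_add power_int_diff)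
  qed
  have lm4: "l * m = 4" using lm by auto
  have G_lm: "G / 3 \<le> G / l" "G / 3 \<le> G / m" "3/4 * G \<le> G / l \<or> 3/4 * G \<le> G / m"
    using lm G0 by (elim disjE conjE; hypsubst; simp)+
  have W: "real (weight (insert r J) f) = 2 * real (weight J p) + real (weight J q)"
  proof -
    have "weight J (slice r b f) = weight J p"
      using eq by (intro weight_cong) (auto simp: p_def)
    thus ?thesis
      unfolding weight_insert[OF fJ] sum_three_letters[OF ab(1,2) c(1) ab(3) c(2,3)]
      by (simp add: p_def q_def)
  qed
  have S: "band J i j (\<lambda>x. 2 * p x + q x)"
    using band_slice_sum[OF fJ insert.prems(1)] eq
    unfolding sum_three_letters[OF ab(1,2) c(1) ab(3) c(2,3)]
    by (subst band_cong[where g = "\<lambda>x. slice r a f x + slice r b f x + slice r c f x"])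
      (auto simp: p_def q_def)
  have D: "band J (i - 1) (j - 1) (\<lambda>x. q x - p x)"
    using band_slice_diff[OF fJ insert.prems(1) c(1) ab(1)] by (simp add: p_def q_def)
  have P: "band J (i - 1) j p" and Q: "band J (i - 1) j q"
    using band_slice[OF fJ insert.prems(1)] ab c by (auto simp: p_def q_def)
  have IH: "l powi i' * m powi (int (card J) - j') \<le> real (weight J (\<lambda>x. t * p x + u * q x))"
    if "band J i' j' (\<lambda>x. t * p x + u * q x)" "\<exists>x\<in>cube J. t * p x + u * q x \<noteq> 0" for i' j' t u
    using that insert.IH[of i' j' "\<lambda>x. t * p x + u * q x"] insert.prems(3)
      collapsed_slices[OF _ fJ(2) _ ab(1) c(1)] by (auto simp: p_def q_def)
  have G_diff: "G / l \<le> real (weight J (\<lambda>x. q x - p x))" if "\<exists>x\<in>cube J. q x - p x \<noteq> 0"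
    using IH[of "i - 1" "j - 1" "-1" 1] D that low(1) by simp
  have G_sum: "G / m \<le> real (weight J (\<lambda>x. 2 * p x + q x))" if "\<exists>x\<in>cube J. 2 * p x + q x \<noteq> 0"
    using IH[of i j 2 1] S that low(2) by simp
  have G_p: "G / 4 \<le> real (weight J p)" if "\<exists>x\<in>cube J. p x \<noteq> 0"
    using IH[of "i - 1" j 1 0] P that low(3) lm4 by simp
  have G_q: "G / 4 \<le> real (weight J q)" if "\<exists>x\<in>cube J. q x \<noteq> 0"
    using IH[of "i - 1" j 0 1] Q that low(3) lm4 by simp
  have comb: "weight J (\<lambda>x. t * p x + u * q x) \<le> weight J p + weight J q" for t u
    using weight_combination_le[OF fJ(1)] by simp
  have nonzero: "\<exists>x\<in>cube J. p x \<noteq> 0 \<or> q x \<noteq> 0"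
  proof -
    obtain y where y: "y \<in> cube (insert r J)" "f y \<noteq> 0"
      using insert.prems(2) by blast
    from y(1) fJ(2) obtain x d where x: "x \<in> cube J" "d < 3" "y = x(r := d)"
      by (rule cube_insertE)
    have "slice r d f x \<noteq> 0"
      using y(2) x(3) by (simp add: slice_def)
    moreover have "d \<in> {a, b, c}"
      using ab c x(2) by auto
    ultimately have "p x \<noteq> 0 \<or> q x \<noteq> 0"
      using eq[OF x(1)] by (auto simp: p_def q_def)
    thus ?thesis
      using x(1) by blast
  qed
  \<comment> \<open>If \<open>p\<close> or \<open>q\<close> vanishes, the other one is proportional both to \<open>q - p\<close> and to \<open>2 p + q\<close>, so it
    lies in the intersection of their two ranges, for which the bound is the full \<open>G\<close>.\<close>
  consider (p0) "\<forall>x\<in>cube J. p x = 0" | (q0) "\<forall>x\<in>cube J. q x = 0"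
    | (diff0) "\<forall>x\<in>cube J. q x - p x = 0" "\<exists>x\<in>cube J. p x \<noteq> 0"
    | (sum0) "\<forall>x\<in>cube J. 2 * p x + q x = 0" "\<exists>x\<in>cube J. p x \<noteq> 0"
    | (generic) "\<exists>x\<in>cube J. p x \<noteq> 0" "\<exists>x\<in>cube J. q x - p x \<noteq> 0" "\<exists>x\<in>cube J. 2 * p x + q x \<noteq> 0"
    by blast
  hence "G \<le> 2 * real (weight J p) + real (weight J q)"
  proof cases
    case p0
    have "\<exists>x\<in>cube J. q x \<noteq> 0"
      using nonzero p0 by blast
    moreover have "band J i (j - 1) q"
      using band_Int[of J i j q "i - 1" "j - 1"] S D p0
        band_cong[of J "\<lambda>x. 2 * p x + q x" q] band_cong[of J "\<lambda>x. q x - p x" q] by simp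
    ultimately show ?thesis
      using IH[of i "j - 1" 0 1] low(4) by simp
  next
    case q0
    have "\<exists>x\<in>cube J. p x \<noteq> 0"
      using nonzero q0 by blast
    moreover have "band J i (j - 1) p"
      using band_Int[of J i j p "i - 1" "j - 1"] band_scale[OF S, of "1/2"] band_scale[OF D, of "-1"] q0
        band_cong[of J "\<lambda>x. 1/2 * (2 * p x + q x)" p] band_cong[of J "\<lambda>x. -1 * (q x - p x)" p] by simp
    ultimately show ?thesis
      using IH[of i "j - 1" 1 0] low(4) by simp
  next
    case diff0
    hence "weight J q = weight J p" "weight J (\<lambda>x. 2 * p x + q x) = weight J p"
      by (auto intro!: weight_cong)
    moreover have "\<exists>x\<in>cube J. 2 * p x + q x \<noteq> 0"
      using diff0 by force
    ultimately show ?thesis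
      using G_sum G_lm(2) by linarith
  next
    case sum0
    have pq: "q x = - 2 * p x" if "x \<in> cube J" for x
      using sum0(1) that by force
    have "weight J q = weight J p" "weight J (\<lambda>x. q x - p x) = weight J p"
      using pq by (auto intro!: weight_cong)
    moreover have "\<exists>x\<in>cube J. q x - p x \<noteq> 0"
      using sum0(2) pq by force
    ultimately show ?thesis
      using G_diff G_lm(1) by linarith
  next
    case generic
    have "G / m \<le> real (weight J p) + real (weight J q)" "G / l \<le> real (weight J p) + real (weight J q)"
      using G_sum[OF generic(3)] G_diff[OF generic(2)] comb[of 2 1] comb[of "-1" 1] by simp_all
    hence "3/4 * G \<le> real (weight J p) + real (weight J q)"
      using G_lm(3) order.trans by blast
    thus ?thesis
      using G_p[OF generic(1)] by linarith
  qed
  thus ?case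
    unfolding W G_def by simp
qed

text \<open>Both bounds for collapsed functions equal $4^i$ at $i = n - j$, as does the bound wanted
  here; away from this point the ratios $3$ against $8/3$ and $3$ against $3/2$ decide.\<close>

lemma weight_collapsed_bound:
  assumes "finite I" "band I i j f" "\<exists>x\<in>cube I. f x \<noteq> 0" "\<forall>r\<in>I. collapsed I f r"
  shows "(3/2) powi i * (8/3) powi (int (card I) - j) \<le> weight I f"
proof (cases "i \<le> int (card I) - j")
  case True
  define d where "d = nat (int (card I) - j - i)"
  have "(3/2::real) powi i * (8/3) powi (i + int d) = 4 powi i * (8/3) ^ d"
    by (simp add: power_int_add power_int_mult_distrib[symmetric])
  also have "\<dots> \<le> 4 powi i * 3 ^ d"
    by (intro mult_left_mono power_mono) auto
  also have "\<dots> = (4/3) powi i * 3 powi (i + int d)"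
    by (simp add: power_int_add power_int_mult_distrib[symmetric])
  finally show ?thesis
    using weight_collapsed[OF assms, of "4/3" 3] True by (simp add: d_def)
next
  case False
  define s d where "s = int (card I) - j" and "d = nat (i - s)"
  have "(3/2::real) powi (s + int d) * (8/3) powi s = 4 powi s * (3/2) ^ d"
    by (simp add: power_int_add power_int_mult_distrib[symmetric])
  also have "\<dots> \<le> 4 powi s * 3 ^ d"
    by (intro mult_left_mono power_mono) auto
  also have "\<dots> = 3 powi (s + int d) * (4/3) powi s"
    by (simp add: power_int_add power_int_mult_distrib[symmetric])
  finally show ?thesis
    using weight_collapsed[OF assms, of 3 "4/3"] False by (simp add: d_def s_def)
qed

section \<open>The lower bound on the cube\<close>

lemma weight_band_bound:
  assumes "finite I" "band I i j f" "\<exists>x\<in>cube I. f x \<noteq> 0"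
  shows "(3/2) powi i * (8/3) powi (int (card I) - j) \<le> weight I f"
  using assms
proof (induction "card I" arbitrary: I i j f)
  case 0
  thus ?case
    using weight_collapsed_bound by fastforce
next
  case (Suc n)
  show ?case
  proof (cases "\<forall>r\<in>I. collapsed I f r")
    case True
    thus ?thesis
      using weight_collapsed_bound Suc.prems by blast
  next
    case False
    then obtain r where r: "r \<in> I" "\<not> collapsed I f r" by blast
    define J where "J = I - {r}"
    have J: "finite J" "r \<notin> J" "I = insert r J" "card J = n"
      using r Suc by (auto simp: J_def)
    define G :: real where "G = (3/2) powi i * (8/3) powi (int (card I) - j)"
    \<comment> \<open>A coordinate that is not collapsed has three different slices, so no difference vanishes
      and the induction hypothesis applies to each of them.\<close>
    have pair: "2/3 * G \<le> real (weight J (slice r a f)) + weight J (slice r b f)"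
      if "a < 3" "b < 3" "a \<noteq> b" for a b
    proof -
      let ?d = "\<lambda>x. slice r a f x - slice r b f x"
      have "\<exists>x\<in>cube J. ?d x \<noteq> 0"
        using r(2) that unfolding collapsed_def J_def by auto
      moreover have "band J (i - 1) (j - 1) ?d"
        using band_slice_diff[OF J(1,2)] Suc.prems(2) that J(3) by simp
      ultimately have "(3/2) powi (i - 1) * (8/3) powi (int (card J) - (j - 1)) \<le> real (weight J ?d)"
        using Suc.hyps(1)[of J "i - 1" "j - 1" ?d] J by simp
      also have "weight J ?d \<le> weight J (slice r a f) + weight J (slice r b f)"
        by (rule weight_combination_le[OF J(1)]) simp
      finally show ?thesis
        using J Suc.hyps(2) by (simp add: G_def power_int_diff algebra_simps)
    qed
    have "real (weight I f) = weight J (slice r 0 f) + weight J (slice r 1 f) + weight J (slice r 2 f)"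
      using weight_insert[OF J(1,2)] J(3) by (simp add: sum_lessThan_3)
    thus ?thesis
      using pair[of 0 1] pair[of 0 2] pair[of 1 2] unfolding G_def[symmetric] by simp
  qed
qed

section \<open>From words to the cube\<close>

lemma axis_sum_symmetric:
  "(\<Sum>x\<in>cube I. (\<Sum>r\<in>I. \<Sum>b<3. g (x(r := b))) * h x)
       = (\<Sum>x\<in>cube I. g x * (\<Sum>r\<in>I. \<Sum>b<3. h (x(r := b)) :: real))"
proof -
  have "(\<Sum>x\<in>cube I. (\<Sum>b<3. g (x(r := b))) * h x) = (\<Sum>x\<in>cube I. g x * (\<Sum>b<3. h (x(r := b))))"
    if "r \<in> I" for r
  proof -
    define J where "J = I - {r}"
    have J: "r \<notin> J" "I = insert r J"
      using that by (auto simp: J_def)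
    show ?thesis
      unfolding J(2) sum_cube_insert[OF J(1)]
      by (simp add: sum_distrib_left[symmetric] sum_distrib_right[symmetric] mult.commute)
  qed
  hence "(\<Sum>r\<in>I. \<Sum>x\<in>cube I. (\<Sum>b<3. g (x(r := b))) * h x)
      = (\<Sum>r\<in>I. \<Sum>x\<in>cube I. g x * (\<Sum>b<3. h (x(r := b))))"
    by (rule sum.cong[OF refl])
  thus ?thesis
    by (simp add: sum_distrib_left sum_distrib_right sum.swap[of _ "cube I" I])
qed

lemma eigenfun_orthogonal:
  assumes "eigenfun I k g" "eigenfun I l h" "k \<noteq> l"
  shows "(\<Sum>x\<in>cube I. g x * h x) = 0"
proof -
  define c where "c l = 3 * (real (card I) - of_int l)" for l :: int
  have eig: "(\<Sum>r\<in>I. \<Sum>b<3. g (x(r := b))) = c k * g x" "(\<Sum>r\<in>I. \<Sum>b<3. h (x(r := b))) = c l * h x"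
    if "x \<in> cube I" for x
    using assms(1,2) that unfolding eigenfun_def c_def by blast+
  have "c k * (\<Sum>x\<in>cube I. g x * h x) = (\<Sum>x\<in>cube I. (\<Sum>r\<in>I. \<Sum>b<3. g (x(r := b))) * h x)"
    by (simp add: eig sum_distrib_left mult_ac)
  also have "\<dots> = (\<Sum>x\<in>cube I. g x * (\<Sum>r\<in>I. \<Sum>b<3. h (x(r := b))))"
    by (rule axis_sum_symmetric)
  also have "\<dots> = c l * (\<Sum>x\<in>cube I. g x * h x)"
    by (simp add: eig sum_distrib_left mult_ac)
  finally show ?thesis
    using assms(3) by (simp add: c_def)
qed

lemma band_eigenfun_sum:
  assumes "\<And>k. k \<in> {i..j} \<Longrightarrow> eigenfun I (int k) (g k)"
  shows "band I (int i) (int j) (\<lambda>x. \<Sum>k=i..j. g k x)"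
  unfolding band_def
proof (intro allI impI)
  fix l h assume l: "eigenfun I l h \<and> (l < int i \<or> int j < l)"
  have "(\<Sum>x\<in>cube I. (\<Sum>k=i..j. g k x) * h x) = (\<Sum>k=i..j. \<Sum>x\<in>cube I. g k x * h x)"
    by (simp add: sum_distrib_right sum.swap[of _ "cube I"])
  also have "\<dots> = 0"
    using assms l by (intro sum.neutral ballI eigenfun_orthogonal[of I "int k" for k]) auto
  finally show "(\<Sum>x\<in>cube I. (\<Sum>k=i..j. g k x) * h x) = 0" .
qed

lemma hamming_verts_update:
  "x \<in> hamming_verts n q \<Longrightarrow> b < q \<Longrightarrow> x[r := b] \<in> hamming_verts n q"
  unfolding hamming_verts_def using set_update_subset_insert[of x r b] by auto

lemma hamming_nbrs_eq:
  assumes x: "x \<in> hamming_verts n q"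
  shows "hamming_nbrs n q x = (\<lambda>(r, b). x[r := b]) ` (SIGMA r:{..<n}. {..<q} - {x ! r})"
    (is "?N = ?f ` ?S")
proof (intro equalityI subsetI)
  fix y assume y: "y \<in> ?N"
  hence "card {k. k < n \<and> x ! k \<noteq> y ! k} = 1"
    by (simp add: hamming_nbrs_def)
  then obtain r where r: "{k. k < n \<and> x ! k \<noteq> y ! k} = {r}"
    by (rule card_1_singletonE)
  have len: "length x = n" "length y = n" and sety: "set y \<subseteq> {..<q}"
    using x y by (auto simp: hamming_nbrs_def hamming_verts_def)
  have "r \<in> {k. k < n \<and> x ! k \<noteq> y ! k}"
    unfolding r by simp
  hence rn: "r < n" "x ! r \<noteq> y ! r"
    by simp_all
  have "y = x[r := y ! r]"
  proof (rule nth_equalityI)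
    fix k assume "k < length y"
    have "x ! k = y ! k" if "k \<noteq> r"
    proof -
      have "k \<notin> {k. k < n \<and> x ! k \<noteq> y ! k}"
        unfolding r using that by simp
      thus ?thesis
        using \<open>k < length y\<close> len by simp
    qed
    thus "y ! k = x[r := y ! r] ! k"
      using rn len by (cases "k = r") simp_all
  qed (simp add: len)
  moreover have "y ! r < q"
    using sety rn len by (metis lessThan_iff nth_mem subsetD)
  ultimately show "y \<in> ?f ` ?S"
    using rn by (intro image_eqI[of _ _ "(r, y ! r)"]) auto
next
  fix y assume "y \<in> ?f ` ?S"
  then obtain r b where rb: "r < n" "b < q" "b \<noteq> x ! r" "y = x[r := b]"
    by auto
  have "length x = n"
    using x by (simp add: hamming_verts_def)
  hence "{k. k < n \<and> x ! k \<noteq> y ! k} = {r}"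
    using rb by (auto simp: nth_list_update)
  thus "y \<in> ?N"
    using hamming_verts_update[OF x] rb by (simp add: hamming_nbrs_def)
qed

lemma sum_hamming_nbrs:
  assumes x: "x \<in> hamming_verts n q"
  shows "(\<Sum>y\<in>hamming_nbrs n q x. f y) = (\<Sum>r<n. \<Sum>b<q. f (x[r := b])) - real n * f x"
proof -
  have len: "length x = n"
    using x by (simp add: hamming_verts_def)
  have inj: "inj_on (\<lambda>(r, b). x[r := b]) (SIGMA r:{..<n}. {..<q} - {x ! r})"
  proof (rule inj_onI)
    fix s t
    assume st: "s \<in> (SIGMA r:{..<n}. {..<q} - {x ! r})" "t \<in> (SIGMA r:{..<n}. {..<q} - {x ! r})"
      "(case s of (r, b) \<Rightarrow> x[r := b]) = (case t of (r, b) \<Rightarrow> x[r := b])"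
    obtain r b r' b' where s: "s = (r, b)" and t: "t = (r', b')"
      by (cases s, cases t)
    have rb: "r < length x" "b \<noteq> x ! r" "r' < length x" "b' \<noteq> x ! r'" "x[r := b] = x[r' := b']"
      using st len unfolding s t by simp_all
    have "r = r'"
      using rb by (metis nth_list_update_eq nth_list_update_neq)
    moreover have "b = b'"
      using rb \<open>r = r'\<close> by (metis nth_list_update_eq)
    ultimately show "s = t"
      unfolding s t by simp
  qed
  have "(\<Sum>y\<in>hamming_nbrs n q x. f y) = (\<Sum>r<n. \<Sum>b\<in>{..<q} - {x ! r}. f (x[r := b]))"
    unfolding hamming_nbrs_eq[OF x] sum.reindex[OF inj] by (simp add: sum.Sigma case_prod_unfold)
  also have "\<dots> = (\<Sum>r<n. (\<Sum>b<q. f (x[r := b])) - f x)"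
  proof (rule sum.cong[OF refl])
    fix r assume "r \<in> {..<n}"
    hence "x ! r \<in> set x"
      using len by simp
    hence "x ! r \<in> {..<q}"
      using x by (auto simp: hamming_verts_def)
    thus "(\<Sum>b\<in>{..<q} - {x ! r}. f (x[r := b])) = (\<Sum>b<q. f (x[r := b])) - f x"
      by (simp add: sum_diff1)
  qed
  finally show ?thesis
    by (simp add: sum_subtractf)
qed

lemma mem_hamming_eigenspace:
  "f \<in> hamming_eigenspace n q k \<longleftrightarrow>
     (\<forall>x. x \<notin> hamming_verts n q \<longrightarrow> f x = 0) \<and>
     (\<forall>x \<in> hamming_verts n q.
        (\<Sum>r<n. \<Sum>b<q. f (x[r := b])) = real q * (real n - real k) * f x)"
  unfolding hamming_eigenspace_def hamming_eigenvalue_def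
  by (auto simp: sum_hamming_nbrs algebra_simps)

lemma bij_betw_cube_words:
  "bij_betw (\<lambda>x. map x [0..<n]) (cube {..<n}) (hamming_verts n 3)"
proof (rule bij_betw_imageI)
  show "inj_on (\<lambda>x. map x [0..<n]) (cube {..<n})"
  proof (rule inj_onI)
    fix x y assume xy: "x \<in> cube {..<n}" "y \<in> cube {..<n}" "map x [0..<n] = map y [0..<n]"
    show "x = y"
      using xy(1,2) unfolding cube_def by (rule PiE_ext) (use xy(3) in auto)
  qed
  show "(\<lambda>x. map x [0..<n]) ` cube {..<n} = hamming_verts n 3"
  proof (intro equalityI subsetI)
    fix w assume w: "w \<in> hamming_verts n 3"
    hence len: "length w = n" and set: "set w \<subseteq> {..<3}"
      by (simp_all add: hamming_verts_def)
    have "w ! r < 3" if "r < n" for r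
      using nth_mem[of r w] set that len by blast
    hence "(\<lambda>r\<in>{..<n}. w ! r) \<in> cube {..<n}"
      unfolding cube_def by simp
    moreover have "w = map (\<lambda>r\<in>{..<n}. w ! r) [0..<n]"
      by (rule nth_equalityI) (simp_all add: len)
    ultimately show "w \<in> (\<lambda>x. map x [0..<n]) ` cube {..<n}"
      by (intro image_eqI[where x = "\<lambda>r\<in>{..<n}. w ! r"])
  qed (auto simp: cube_def hamming_verts_def PiE_def Pi_def)
qed

lemma eigenfun_of_eigenspace:
  assumes "f \<in> hamming_eigenspace n 3 k"
  shows "eigenfun {..<n} (int k) (\<lambda>x. f (map x [0..<n]))"
  unfolding eigenfun_def
proof
  fix x assume "x \<in> cube {..<n}"
  hence "map x [0..<n] \<in> hamming_verts n 3"
    using bij_betw_cube_words bij_betwE by blast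
  moreover have "map (x(r := b)) [0..<n] = (map x [0..<n])[r := b]" if "r < n" for r b
    using that by (intro nth_equalityI) (auto simp: nth_list_update)
  ultimately show "(\<Sum>r<n. \<Sum>b<3. f (map (x(r := b)) [0..<n]))
      = 3 * (real (card {..<n}) - of_int (int k)) * f (map x [0..<n])"
    using assms by (simp add: mem_hamming_eigenspace)
qed

lemma hamming_eigenspace_sum_outside:
  "f \<in> hamming_eigenspace_sum n q i j \<Longrightarrow> x \<notin> hamming_verts n q \<Longrightarrow> f x = 0"
  by (auto simp: hamming_eigenspace_sum_def mem_hamming_eigenspace intro!: sum.neutral)

lemma card_fun_support_bound:
  assumes f: "f \<in> hamming_eigenspace_sum n 3 i j" "f \<noteq> (\<lambda>x. 0)"
  shows "(3/2) powi int i * (8/3) powi (int n - int j) \<le> real (card (fun_support f))"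
proof -
  obtain g where g: "\<And>k. k \<in> {i..j} \<Longrightarrow> g k \<in> hamming_eigenspace n 3 k"
    and fg: "f = (\<lambda>x. \<Sum>k=i..j. g k x)"
    using f(1) unfolding hamming_eigenspace_sum_def by blast
  let ?w = "\<lambda>x. map x [0..<n]" and ?F = "\<lambda>x. f (map x [0..<n])"
  note bij = bij_betw_cube_words[of n]
  have supp: "fun_support f = ?w ` {x \<in> cube {..<n}. ?F x \<noteq> 0}"
  proof (intro equalityI subsetI)
    fix w assume w: "w \<in> fun_support f"
    hence "w \<in> hamming_verts n 3"
      using hamming_eigenspace_sum_outside[OF f(1), of w] by (auto simp: fun_support_def)
    then obtain x where x: "w = ?w x" "x \<in> cube {..<n}"
      unfolding bij_betw_imp_surj_on[OF bij, symmetric] by (rule imageE)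
    thus "w \<in> ?w ` {x \<in> cube {..<n}. ?F x \<noteq> 0}"
      using w by (intro image_eqI[where x = x]) (simp_all add: fun_support_def x)
  qed (auto simp: fun_support_def)
  have "card (fun_support f) = weight {..<n} ?F"
    unfolding supp weight_def using bij_betw_imp_inj_on[OF bij]
    by (intro card_image) (auto simp: inj_on_def)
  moreover have "\<exists>x\<in>cube {..<n}. ?F x \<noteq> 0"
    using f(2) supp unfolding fun_support_def by fastforce
  moreover have "band {..<n} (int i) (int j) ?F"
    unfolding fg using band_eigenfun_sum[of i j "{..<n}" "\<lambda>k x. g k (?w x)"] g
    by (simp add: eigenfun_of_eigenspace)
  ultimately show ?thesis
    using weight_band_bound[of "{..<n}" "int i" "int j" ?F] by simp
qed

section \<open>Tensor products\<close>

definition tensor :: "nat \<Rightarrow> (nat list \<Rightarrow> real) \<Rightarrow> (nat list \<Rightarrow> real) \<Rightarrow> nat list \<Rightarrow> real" where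
  "tensor m f g = (\<lambda>x. f (take m x) * g (drop m x))"

lemma append_mem_hamming_verts:
  "length x = m \<Longrightarrow> x @ y \<in> hamming_verts (m + n) q \<longleftrightarrow> x \<in> hamming_verts m q \<and> y \<in> hamming_verts n q"
  by (auto simp: hamming_verts_def)

lemma tensor_eigenspace:
  assumes f: "f \<in> hamming_eigenspace m q k" and g: "g \<in> hamming_eigenspace n q l"
  shows "tensor m f g \<in> hamming_eigenspace (m + n) q (k + l)"
  unfolding mem_hamming_eigenspace
proof (intro conjI allI ballI impI)
  fix z assume z: "z \<notin> hamming_verts (m + n) q"
  show "tensor m f g z = 0"
  proof (rule ccontr)
    assume "tensor m f g z \<noteq> 0"
    hence "take m z \<in> hamming_verts m q" "drop m z \<in> hamming_verts n q"
      using f g by (auto simp: tensor_def mem_hamming_eigenspace)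
    thus False
      using z append_mem_hamming_verts[of "take m z" m "drop m z" n q]
      by (simp add: hamming_verts_def)
  qed
next
  fix z assume z: "z \<in> hamming_verts (m + n) q"
  define x y where "x = take m z" and "y = drop m z"
  have len: "length x = m" and z_eq: "z = x @ y"
    using z by (auto simp: x_def y_def hamming_verts_def)
  have xy: "x \<in> hamming_verts m q" "y \<in> hamming_verts n q"
    using z append_mem_hamming_verts[OF len] unfolding z_eq by auto
  have eig: "(\<Sum>r<m. \<Sum>b<q. f (x[r := b])) = real q * (real m - real k) * f x"
    "(\<Sum>r<n. \<Sum>b<q. g (y[r := b])) = real q * (real n - real l) * g y"
    using f g xy unfolding mem_hamming_eigenspace by blast+
  have "(\<Sum>r<m + n. \<Sum>b<q. tensor m f g (z[r := b]))
      = (\<Sum>r<m. \<Sum>b<q. tensor m f g (z[r := b])) + (\<Sum>r<n. \<Sum>b<q. tensor m f g (z[m + r := b]))"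
    by (induction n) (auto simp: add.assoc)
  also have "(\<Sum>r<m. \<Sum>b<q. tensor m f g (z[r := b])) = (\<Sum>r<m. \<Sum>b<q. f (x[r := b])) * g y"
    using len by (simp add: tensor_def z_eq list_update_append sum_distrib_right)
  also have "(\<Sum>r<n. \<Sum>b<q. tensor m f g (z[m + r := b])) = f x * (\<Sum>r<n. \<Sum>b<q. g (y[r := b]))"
    using len by (simp add: tensor_def z_eq list_update_append sum_distrib_left)
  also have "(\<Sum>r<m. \<Sum>b<q. f (x[r := b])) * g y + f x * (\<Sum>r<n. \<Sum>b<q. g (y[r := b]))
      = real q * (real (m + n) - real (k + l)) * tensor m f g z"
    unfolding eig using len by (simp add: tensor_def z_eq algebra_simps)
  finally show "(\<Sum>r<m + n. \<Sum>b<q. tensor m f g (z[r := b])) = \<dots>" .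
qed

lemma hamming_eigenspace_add:
  assumes "f \<in> hamming_eigenspace n q k" "g \<in> hamming_eigenspace n q k"
  shows "(\<lambda>x. f x + g x) \<in> hamming_eigenspace n q k"
  using assms unfolding mem_hamming_eigenspace by (simp add: sum.distrib distrib_left)

lemma hamming_eigenspace_sum_add:
  assumes "f \<in> hamming_eigenspace_sum n q i j" "g \<in> hamming_eigenspace_sum n q i j"
  shows "(\<lambda>x. f x + g x) \<in> hamming_eigenspace_sum n q i j"
proof -
  obtain F G where "\<forall>k\<in>{i..j}. F k \<in> hamming_eigenspace n q k" "f = (\<lambda>x. \<Sum>k=i..j. F k x)"
    "\<forall>k\<in>{i..j}. G k \<in> hamming_eigenspace n q k" "g = (\<lambda>x. \<Sum>k=i..j. G k x)"
    using assms unfolding hamming_eigenspace_sum_def by blast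
  thus ?thesis
    unfolding hamming_eigenspace_sum_def
    by (intro CollectI exI[of _ "\<lambda>k x. F k x + G k x"]) (simp add: sum.distrib hamming_eigenspace_add)
qed

lemma zero_mem_hamming_eigenspace: "(\<lambda>x. 0) \<in> hamming_eigenspace n q k"
  by (simp add: mem_hamming_eigenspace)

lemma hamming_eigenspace_sumI:
  assumes "f \<in> hamming_eigenspace n q k" "k \<in> {i..j}"
  shows "f \<in> hamming_eigenspace_sum n q i j"
  unfolding hamming_eigenspace_sum_def
proof (intro CollectI exI conjI)
  show "\<forall>l\<in>{i..j}. (\<lambda>x. if l = k then f x else 0) \<in> hamming_eigenspace n q l"
  proof
    fix l
    show "(\<lambda>x. if l = k then f x else 0) \<in> hamming_eigenspace n q l"
      using assms(1) zero_mem_hamming_eigenspace by (cases "l = k") simp_all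
  qed
  show "f = (\<lambda>x. \<Sum>l=i..j. if l = k then f x else 0)"
    using assms(2) by auto
qed

lemma hamming_eigenspace_sum_sum:
  assumes "finite A" "\<And>a. a \<in> A \<Longrightarrow> f a \<in> hamming_eigenspace_sum n q i j"
  shows "(\<lambda>x. \<Sum>a\<in>A. f a x) \<in> hamming_eigenspace_sum n q i j"
  using assms
proof (induction A rule: finite_induct)
  case empty
  show ?case
    using zero_mem_hamming_eigenspace unfolding hamming_eigenspace_sum_def
    by (intro CollectI exI[of _ "\<lambda>_ _. 0"]) simp
qed (simp add: hamming_eigenspace_sum_add)

lemma tensor_eigenspace_sum:
  assumes "f \<in> hamming_eigenspace_sum m q i j" "g \<in> hamming_eigenspace_sum n q i' j'"
  shows "tensor m f g \<in> hamming_eigenspace_sum (m + n) q (i + i') (j + j')"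
proof -
  obtain F G where F: "\<And>k. k \<in> {i..j} \<Longrightarrow> F k \<in> hamming_eigenspace m q k" "f = (\<lambda>x. \<Sum>k=i..j. F k x)"
    and G: "\<And>k. k \<in> {i'..j'} \<Longrightarrow> G k \<in> hamming_eigenspace n q k" "g = (\<lambda>x. \<Sum>k=i'..j'. G k x)"
    using assms unfolding hamming_eigenspace_sum_def by blast
  have "tensor m f g = (\<lambda>x. \<Sum>(k, l)\<in>{i..j} \<times> {i'..j'}. tensor m (F k) (G l) x)"
    unfolding F(2) G(2) tensor_def by (simp add: sum_product sum.cartesian_product)
  also have "\<dots> = (\<lambda>x. \<Sum>p\<in>{i..j} \<times> {i'..j'}. tensor m (F (fst p)) (G (snd p)) x)"
    by (simp add: case_prod_unfold)
  also have "\<dots> \<in> hamming_eigenspace_sum (m + n) q (i + i') (j + j')"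
  proof (rule hamming_eigenspace_sum_sum)
    fix p assume "p \<in> {i..j} \<times> {i'..j'}"
    thus "tensor m (F (fst p)) (G (snd p)) \<in> hamming_eigenspace_sum (m + n) q (i + i') (j + j')"
      using F(1) G(1) by (intro hamming_eigenspace_sumI[OF tensor_eigenspace[of _ _ _ "fst p" _ _ "snd p"]]) auto
  qed simp
  finally show ?thesis .
qed

lemma card_fun_support_tensor:
  assumes "\<And>x. f x \<noteq> 0 \<Longrightarrow> length x = m"
  shows "card (fun_support (tensor m f g)) = card (fun_support f) * card (fun_support g)"
proof -
  have "bij_betw (\<lambda>(x, y). x @ y) (fun_support f \<times> fun_support g) (fun_support (tensor m f g))"
    using assms
    by (intro bij_betwI[where g = "\<lambda>z. (take m z, drop m z)"])
      (auto simp: fun_support_def tensor_def)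
  thus ?thesis
    by (metis bij_betw_same_card card_cartesian_product)
qed

section \<open>Functions with small support\<close>

definition attained :: "nat \<Rightarrow> nat \<Rightarrow> nat \<Rightarrow> nat \<Rightarrow> bool" where
  "attained n i j N \<longleftrightarrow> (\<exists>f \<in> hamming_eigenspace_sum n 3 i j. card (fun_support f) = N)"

lemma attained_mult:
  assumes "attained m i j M" "attained n i' j' N"
  shows "attained (m + n) (i + i') (j + j') (M * N)"
proof -
  obtain f g where f: "f \<in> hamming_eigenspace_sum m 3 i j" "card (fun_support f) = M"
    and g: "g \<in> hamming_eigenspace_sum n 3 i' j'" "card (fun_support g) = N"
    using assms unfolding attained_def by blast
  have "length x = m" if "f x \<noteq> 0" for x
    using hamming_eigenspace_sum_outside[OF f(1), of x] that by (auto simp: hamming_verts_def)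
  thus ?thesis
    unfolding attained_def
    using tensor_eigenspace_sum[OF f(1) g(1)] card_fun_support_tensor[of f m g] f(2) g(2) by auto
qed

lemma attained_empty: "attained 0 0 0 1"
proof -
  have "(\<lambda>x. of_bool (x = [])) \<in> hamming_eigenspace 0 3 0"
    by (auto simp: mem_hamming_eigenspace hamming_verts_def)
  hence "(\<lambda>x. of_bool (x = [])) \<in> hamming_eigenspace_sum 0 3 0 0"
    by (rule hamming_eigenspace_sumI) simp
  thus ?thesis
    unfolding attained_def by (intro bexI[of _ "\<lambda>x. of_bool (x = [])"]) (auto simp: fun_support_def)
qed

lemma attained_power:
  assumes "attained n i j N"
  shows "attained (a * n) (a * i) (a * j) (N ^ a)"
proof (induction a)
  case 0
  thus ?case using attained_empty by simp
next
  case (Suc a)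
  thus ?case using attained_mult[OF assms] by simp
qed

text \<open>The indicator of a point on a line is the constant $1/3$ plus a function with sum zero.\<close>

lemma attained_point: "attained 1 0 1 1"
proof -
  define f :: "nat list \<Rightarrow> real" where "f x = of_bool (x = [0])" for x
  define c d :: "nat list \<Rightarrow> real"
    where "c x = of_bool (x \<in> hamming_verts 1 3) / 3" and "d x = f x - c x" for x
  have V: "x \<in> hamming_verts 1 3 \<longleftrightarrow> (\<exists>a<3. x = [a])" for x
    by (auto simp: hamming_verts_def length_Suc_conv)
  have axis: "(\<Sum>r<1. \<Sum>b<3. g (x[r := b])) = g [0] + g [1] + (g [2] :: real)"
    if "x \<in> hamming_verts 1 3" for x g
    using that unfolding V by (auto simp: sum_lessThan_3)
  have c1: "c [a] = 1/3" if "a < 3" for a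
    using that by (simp add: c_def hamming_verts_def)
  have "c \<in> hamming_eigenspace 1 3 0"
    unfolding mem_hamming_eigenspace
  proof (intro conjI allI impI ballI)
    fix x assume x: "x \<in> hamming_verts 1 3"
    show "(\<Sum>r<1. \<Sum>b<3. c (x[r := b])) = real 3 * (real 1 - real 0) * c x"
      unfolding axis[OF x] using x by (simp add: c1) (simp add: c_def)
  qed (simp add: c_def)
  moreover have "d \<in> hamming_eigenspace 1 3 1"
    unfolding mem_hamming_eigenspace
  proof (intro conjI allI impI ballI)
    fix x assume x: "x \<in> hamming_verts 1 3"
    show "(\<Sum>r<1. \<Sum>b<3. d (x[r := b])) = real 3 * (real 1 - real 1) * d x"
      unfolding axis[OF x] by (simp add: d_def f_def c1)
  next
    fix x assume x: "x \<notin> hamming_verts 1 3"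
    hence "x \<noteq> [0]"
      by (auto simp: hamming_verts_def)
    thus "d x = 0"
      using x by (simp add: d_def f_def c_def)
  qed
  ultimately have "c \<in> hamming_eigenspace_sum 1 3 0 1" "d \<in> hamming_eigenspace_sum 1 3 0 1"
    by (auto intro: hamming_eigenspace_sumI)
  hence "(\<lambda>x. c x + d x) \<in> hamming_eigenspace_sum 1 3 0 1"
    by (rule hamming_eigenspace_sum_add)
  moreover have "(\<lambda>x. c x + d x) = f"
    by (simp add: d_def)
  moreover have "fun_support f = {[0]}"
    by (simp add: f_def fun_support_def)
  ultimately show ?thesis
    unfolding attained_def by (intro bexI[of _ f]) simp_all
qed

text \<open>The difference of the indicators of $x_1 = 0$ and $x_2 = 0$, a sum of two functions of one
  coordinate each. The common point of the two lines cancels, which leaves two points on each.\<close>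

lemma attained_cross: "attained 2 1 1 4"
proof -
  define f :: "nat list \<Rightarrow> real"
    where "f x = of_bool (x \<in> {[0,1],[0,2]}) - of_bool (x \<in> {[1,0],[2,0]})" for x
  have V: "x \<in> hamming_verts 2 3 \<longleftrightarrow> (\<exists>a<3. \<exists>b<3. x = [a, b])" for x
    by (auto simp: hamming_verts_def numeral_2_eq_2 length_Suc_conv)
  have axis: "(\<Sum>r<2. \<Sum>d<3. f ([a, b][r := d])) = (\<Sum>d<3. f [d, b]) + (\<Sum>d<3. f [a, d])" for a b
    by (simp add: numeral_2_eq_2)
  have "f \<in> hamming_eigenspace 2 3 1"
    unfolding mem_hamming_eigenspace
  proof (intro conjI allI impI ballI)
    fix x assume "x \<notin> hamming_verts 2 3"
    thus "f x = 0" unfolding V f_def by auto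
  next
    fix x assume "x \<in> hamming_verts 2 3"
    then obtain a b where x: "x = [a, b]" and ab: "a < 3" "b < 3"
      unfolding V by blast
    have "a = 0 \<or> a = 1 \<or> a = 2" "b = 0 \<or> b = 1 \<or> b = 2"
      using ab by linarith+
    thus "(\<Sum>r<2. \<Sum>d<3. f (x[r := d])) = real 3 * (real 2 - real 1) * f x"
      unfolding x axis unfolding sum_lessThan_3 by (elim disjE) (simp_all add: f_def)
  qed
  hence "f \<in> hamming_eigenspace_sum 2 3 1 1"
    by (rule hamming_eigenspace_sumI) simp
  moreover have "fun_support f = {[0,1],[0,2],[1,0],[2,0]}"
    by (auto simp: f_def fun_support_def split: if_splits)
  ultimately show ?thesis
    unfolding attained_def by (intro bexI[of _ f]) auto
qed

text \<open>The sign of a permutation of the three letters, extended by zero. It has sum zero along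
  every plane, since half of the permutations with a fixed value are odd; and it is orthogonal to
  $u \otimes v \otimes w$ for $u, v, w$ with sum zero, since this pairing is a determinant of
  three vectors of a plane. Hence only the index 2 remains.\<close>

lemma attained_sign: "attained 3 2 2 6"
proof -
  define f :: "nat list \<Rightarrow> real"
    where "f x = of_bool (x \<in> {[0,1,2],[1,2,0],[2,0,1]}) - of_bool (x \<in> {[0,2,1],[2,1,0],[1,0,2]})" for x
  have V: "x \<in> hamming_verts 3 3 \<longleftrightarrow> (\<exists>a<3. \<exists>b<3. \<exists>c<3. x = [a, b, c])" for x
  proof
    assume "x \<in> hamming_verts 3 3"
    moreover then obtain a b c where "x = [a, b, c]"
      unfolding hamming_verts_def numeral_3_eq_3 by (auto simp: length_Suc_conv)
    ultimately show "\<exists>a<3. \<exists>b<3. \<exists>c<3. x = [a, b, c]"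
      by (simp add: hamming_verts_def)
  qed (auto simp: hamming_verts_def)
  have axis: "(\<Sum>r<3. \<Sum>d<3. f ([a, b, c][r := d]))
      = (\<Sum>d<3. f [d, b, c]) + (\<Sum>d<3. f [a, d, c]) + (\<Sum>d<3. f [a, b, d])" for a b c
    unfolding sum_lessThan_3[of "\<lambda>r. \<Sum>d<3. f ([a, b, c][r := d])"]
    by (simp add: numeral_2_eq_2)
  have "f \<in> hamming_eigenspace 3 3 2"
    unfolding mem_hamming_eigenspace
  proof (intro conjI allI impI ballI)
    fix x assume "x \<notin> hamming_verts 3 3"
    thus "f x = 0" unfolding V f_def by auto
  next
    fix x assume "x \<in> hamming_verts 3 3"
    then obtain a b c where x: "x = [a, b, c]" and abc: "a < 3" "b < 3" "c < 3"
      unfolding V by blast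
    have "a = 0 \<or> a = 1 \<or> a = 2" "b = 0 \<or> b = 1 \<or> b = 2" "c = 0 \<or> c = 1 \<or> c = 2"
      using abc by linarith+
    thus "(\<Sum>r<3. \<Sum>d<3. f (x[r := d])) = real 3 * (real 3 - real 2) * f x"
      unfolding x axis unfolding sum_lessThan_3 by (elim disjE) (simp_all add: f_def)
  qed
  hence "f \<in> hamming_eigenspace_sum 3 3 2 2"
    by (rule hamming_eigenspace_sumI) simp
  moreover have "fun_support f = {[0,1,2],[1,2,0],[2,0,1],[0,2,1],[2,1,0],[1,0,2]}"
    by (auto simp: f_def fun_support_def split: if_splits)
  ultimately show ?thesis
    unfolding attained_def by (intro bexI[of _ f]) auto
qed

theorem theorem5:
  fixes n i j :: nat
  assumes "n \<ge> 1" and "i \<le> j" and "j \<le> n"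
    and "real i / 2 + real j \<le> real n" and "i + j > n"
  shows "(\<forall>f \<in> hamming_eigenspace_sum n 3 i j. f \<noteq> (\<lambda>x. 0) \<longrightarrow>
            card (fun_support f) \<ge> 2 ^ (3 * (n - j) - i) * 3 ^ (i + j - n)) \<and>
         (\<exists>f \<in> hamming_eigenspace_sum n 3 i j. f \<noteq> (\<lambda>x. 0) \<and>
            card (fun_support f) = 2 ^ (3 * (n - j) - i) * 3 ^ (i + j - n))"
proof -
  \<comment> \<open>The multiplicities of the sign, the cross and the point in the extremal tensor product. They
    solve the system for \<open>n\<close>, \<open>i\<close>, \<open>j\<close> below.\<close>
  define a b c where "a = i + j - n" and "b = 2 * (n - j) - i" and "c = j - i"
  have "i \<le> 2 * (n - j)"
    using assms(3,4) by linarith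
  hence eqs: "n = a * 3 + (b * 2 + c * 1)" "i = a * 2 + (b * 1 + c * 0)" "j = a * 2 + (b * 1 + c * 1)"
    and expo: "3 * (n - j) - i = a + 2 * b" "i + j - n = a"
    using assms unfolding a_def b_def c_def by auto
  have val: "(6::nat) ^ a * (4 ^ b * 1 ^ c) = 2 ^ (a + 2 * b) * 3 ^ a"
    by (simp add: power_add power_mult power_mult_distrib[symmetric])
  have "attained n i j (6 ^ a * (4 ^ b * 1 ^ c))"
    unfolding eqs
    by (intro attained_mult attained_power attained_sign attained_cross attained_point)
  hence "\<exists>f \<in> hamming_eigenspace_sum n 3 i j. card (fun_support f) = 2 ^ (a + 2 * b) * 3 ^ a"
    unfolding attained_def val .
  moreover have "f \<noteq> (\<lambda>x. 0)" if "card (fun_support f) = 2 ^ (a + 2 * b) * 3 ^ a" for f :: "nat list \<Rightarrow> real"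
    using that by (auto simp: fun_support_def)
  moreover have "2 ^ (a + 2 * b) * 3 ^ a \<le> card (fun_support f)"
    if f: "f \<in> hamming_eigenspace_sum n 3 i j" "f \<noteq> (\<lambda>x. 0)" for f
  proof -
    have i: "int i = int (a + a + b)" and s: "int n - int j = int (a + b)"
      using eqs by auto
    have "real (2 ^ (a + 2 * b) * 3 ^ a) = ((3/2) * (3/2) * (8/3)) ^ a * ((3/2) * (8/3)) ^ b"
      unfolding val[symmetric] by simp
    also have "\<dots> = (3/2) powi int i * (8/3) powi (int n - int j)"
      unfolding i s power_int_of_nat
      by (simp only: power_mult_distrib power_add mult_ac)
    also have "\<dots> \<le> real (card (fun_support f))"
      by (rule card_fun_support_bound[OF f])
    finally show ?thesis
      by linarith
  qed
  ultimately show ?thesis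
    unfolding expo by blast
qed

end
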